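(* Let $\mathcal{F}=\{\mathbb{X};\,f_1,\dots,f_N\}$ be an iterated function system on a complete metric space $\mathbb{X}$ with point-fibred attractor $A$ and fast basin $\widehat{B}$. Then the extended coding map $\pi$ restricts to a surjection $\pi:\widehat{\mathbb{I}}\to\widehat{B}$, and for all $n\in I_-$, $$\pi\circ\sigma_n=f_n\circ\pi\quad\text{as maps }\widehat{\mathbb{I}}\to\widehat{B},\quad\text{with }\sigma_n:\widehat{\mathbb{I}}\to\widehat{\mathbb{I}},\ f_n:\widehat{B}\to\widehat{B}.$$ Let $\widehat{B}^*$ denote the fast basin of the dual IFS $\mathcal{F}^*$. If $A^*=\mathbb{X}\setminus B(A)$ is a point-fibred attractor of the dual IFS $\mathcal{F}^*$, then $\pi^*:\widehat{\mathbb{I}}^*\to\widehat{B}^*$ is surjective, and for all $n\in I_+$, $$\pi^*\circ\sigma_n=f_n\circ\pi^*\quad\text{as maps }\widehat{\mathbb{I}}^*\to\widehat{B}^*,\quad\text{with }\sigma_n:\widehat{\mathbb{I}}^*\to\widehat{\mathbb{I}}^*,\ f_n:\widehat{B}^*\to\widehat{B}^*.$$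
   Context: An iterated function system (IFS) $\mathcal{F}=\{\mathbb{X};\,f_1,\dots,f_N\}$ is a complete metric space $(\mathbb{X},d_{\mathbb{X}})$ together with finitely many homeomorphisms $f_n:\mathbb{X}\to\mathbb{X}$ of $\mathbb{X}$ onto itself. $H$ is the set of nonempty compact subsets of $\mathbb{X}$ with the Hausdorff metric. For $S\subset\mathbb{X}$, $F(S)=\bigcup_{n=1}^N f_n(S)$, and $F^k$ is the $k$-fold iterate of $F$. An attractor of $\mathcal{F}$ is a set $A\in H$ with $F(A)=A$ for which there is an open set $U\supset A$ such that $F^k(C)\to A$ in the Hausdorff metric for every $C\in H$ with $C\subset U$. The union of all such open sets $U$ is the basin $B(A)$ of $A$. The fast basin of $A$ (w.r.t. $\mathcal{F}$) is $\widehat{B}=\{x\in\mathbb{X}:F^K(\{x\})\cap A\neq\varnothing\text{ for some }K\in\mathbb{N}\}$, $\mathbb{N}=\{1,2,\dots\}$. The dual IFS is $\mathcal{F}^*=\{\mathbb{X};\,f_n^{-1},\ n=1,\dots,N\}$; $\widehat{B}^*$ is the fast basin of $A^*$ with respect to $\mathcal{F}^*$. $I_+=\{1,\dots,N\}$, $I_-=\{-1,\dots,-N\}$, $I=I_+\cup I_-$; $\mathbb{I}_+=I_+^\infty$, $\mathbb{I}_-=I_-^\infty$, $\mathbb{I}=\{\iota\in I^\infty:\iota_i\neq-\iota_{i+1}\text{ for all } i\}$ (infinite words indexed by $\mathbb{N}$). Let $$\widehat{\mathbb{I}}=\{\iota\in\mathbb{I}:\exists k\in\mathbb{N},\ \iota_j\in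 I_-\text{ for }j<k,\ \iota_j\in I_+\text{ for }j\geq k\},$$ $$\widehat{\mathbb{I}}^*=\{\iota\in\mathbb{I}:\exists k\in\mathbb{N},\ \iota_j\in I_+\text{ for }j<k,\ \iota_j\in I_-\text{ for }j\geq k\}.$$ For $n\in I$, $\sigma_n:\mathbb{I}\to\mathbb{I}$ is $\sigma_n(\iota_1\iota_2\cdots)=n\iota_1\iota_2\cdots$ if $\iota_1\neq-n$ and $=\iota_2\iota_3\cdots$ if $\iota_1=-n$. Set $f_{-n}=f_n^{-1}$ for $n\in I_+$ and $f_{\iota|k}=f_{\iota_1}\circ\cdots\circ f_{\iota_k}$. $A$ is point-fibred (w.r.t. $\mathcal{F}$) if for every $\iota\in\mathbb{I}_+$ the limit $\lim_{k\to\infty}f_{\iota|k}(C)$ exists in the Hausdorff metric for all $C\in H$ with $C\subset B(A)$, is a singleton subset of $A$, and is independent of $C$ (analogously for $A^*$ and $\mathcal{F}^*$, with $\iota\in\mathbb{I}_-$). The extended coding map is $\pi(\iota)=\lim_{k\to\infty}f_{\iota|k}(b)$ for $b\in B(A)$; it is well defined, independently of $b$, for all $\iota\in\mathbb{I}$ whose letters are eventually all in $I_+$, in particular on $\widehat{\mathbb{I}}$. Likewise $\pi^*(\iota)=\lim_{k\to\infty}f_{\iota|k}(b)$ with $b$ in the basin of $A^*$ w.r.t. $\mathcal{F}^*$, for $\iota\in\mathbb{I}$ whose letters are eventually all in $I_-$. *)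

theory Defs
  imports "HOL-Analysis.Analysis" "HOL-Library.Stream"
begin

text \<open>The metric is real-valued and \<^term>\<open>Sup\<close> on the reals is only meaningful for bounded
  nonempty sets, so this is the Hausdorff distance for nonempty compact (more generally bounded)
  arguments only.\<close>

definition hausdorff_dist :: "'a::metric_space set \<Rightarrow> 'a set \<Rightarrow> real" where
  "hausdorff_dist S T = max (SUP x\<in>S. infdist x T) (SUP y\<in>T. infdist y S)"

definition hausdorff_tendsto :: "(nat \<Rightarrow> 'a::metric_space set) \<Rightarrow> 'a set \<Rightarrow> bool" where
  "hausdorff_tendsto S T \<longleftrightarrow> (\<lambda>k. hausdorff_dist (S k) T) \<longlonglongrightarrow> 0"

definition nonempty_compacts :: "'a::metric_space set set" where
  "nonempty_compacts = {C. compact C \<and> C \<noteq> {}}"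

text \<open>The maps of an IFS are \<open>f 1, \<dots>, f N\<close>; the values of \<open>f\<close> at other indices play no role.\<close>

definition ifs :: "nat \<Rightarrow> (nat \<Rightarrow> 'a::complete_space \<Rightarrow> 'a) \<Rightarrow> bool" where
  "ifs N f \<longleftrightarrow> 1 \<le> N \<and> (\<forall>n\<in>{1..N}. \<exists>g. homeomorphism UNIV UNIV (f n) g)"

definition dual :: "(nat \<Rightarrow> 'a \<Rightarrow> 'a) \<Rightarrow> nat \<Rightarrow> 'a \<Rightarrow> 'a" where
  "dual f n = inv (f n)"

definition hutchinson :: "nat \<Rightarrow> (nat \<Rightarrow> 'a \<Rightarrow> 'a) \<Rightarrow> 'a set \<Rightarrow> 'a set" where
  "hutchinson N f S = (\<Union>n\<in>{1..N}. f n ` S)"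

definition attracting_nhd ::
    "nat \<Rightarrow> (nat \<Rightarrow> 'a::complete_space \<Rightarrow> 'a) \<Rightarrow> 'a set \<Rightarrow> 'a set \<Rightarrow> bool" where
  "attracting_nhd N f A U \<longleftrightarrow> open U \<and> A \<subseteq> U \<and>
     (\<forall>C\<in>nonempty_compacts. C \<subseteq> U \<longrightarrow> hausdorff_tendsto (\<lambda>k. (hutchinson N f ^^ k) C) A)"

definition attractor :: "nat \<Rightarrow> (nat \<Rightarrow> 'a::complete_space \<Rightarrow> 'a) \<Rightarrow> 'a set \<Rightarrow> bool" where
  "attractor N f A \<longleftrightarrow>
     A \<in> nonempty_compacts \<and> hutchinson N f A = A \<and> (\<exists>U. attracting_nhd N f A U)"

definition basin :: "nat \<Rightarrow> (nat \<Rightarrow> 'a::complete_space \<Rightarrow> 'a) \<Rightarrow> 'a set \<Rightarrow> 'a set" where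
  "basin N f A = \<Union>{U. attracting_nhd N f A U}"

definition fast_basin :: "nat \<Rightarrow> (nat \<Rightarrow> 'a \<Rightarrow> 'a) \<Rightarrow> 'a set \<Rightarrow> 'a set" where
  "fast_basin N f A = {x. \<exists>K\<ge>1. (hutchinson N f ^^ K) {x} \<inter> A \<noteq> {}}"

text \<open>Letters are integers and infinite words are streams. Streams are indexed from \<open>0\<close>, so the
  letter \<open>\<iota>\<^sub>i\<close> of a word indexed by \<open>1, 2, \<dots>\<close> is \<open>\<iota> !! (i - 1)\<close>.\<close>

definition pos_letters :: "nat \<Rightarrow> int set" where
  "pos_letters N = {1..int N}"

definition neg_letters :: "nat \<Rightarrow> int set" where
  "neg_letters N = {- int N..-1}"

definition words :: "nat \<Rightarrow> int stream set" where
  "words N = {\<iota> \<in> streams (pos_letters N \<union> neg_letters N). \<forall>i. \<iota> !! i \<noteq> - (\<iota> !! Suc i)}"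

definition words_neg_pos :: "nat \<Rightarrow> int stream set" where
  "words_neg_pos N = {\<iota> \<in> words N. \<exists>k.
     (\<forall>j<k. \<iota> !! j \<in> neg_letters N) \<and> (\<forall>j\<ge>k. \<iota> !! j \<in> pos_letters N)}"

definition words_pos_neg :: "nat \<Rightarrow> int stream set" where
  "words_pos_neg N = {\<iota> \<in> words N. \<exists>k.
     (\<forall>j<k. \<iota> !! j \<in> pos_letters N) \<and> (\<forall>j\<ge>k. \<iota> !! j \<in> neg_letters N)}"

definition shift_letter :: "int \<Rightarrow> int stream \<Rightarrow> int stream" where
  "shift_letter n \<iota> = (if shd \<iota> = - n then stl \<iota> else n ## \<iota>)"

definition letter_map :: "(nat \<Rightarrow> 'a \<Rightarrow> 'a) \<Rightarrow> int \<Rightarrow> 'a \<Rightarrow> 'a" where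
  "letter_map f n = (if n > 0 then f (nat n) else inv (f (nat (- n))))"

text \<open>\<open>word_map f \<iota> k\<close> is the composition of the maps of the first \<open>k\<close> letters of \<open>\<iota>\<close>, with the map
  of the first letter outermost.\<close>

definition word_map :: "(nat \<Rightarrow> 'a \<Rightarrow> 'a) \<Rightarrow> int stream \<Rightarrow> nat \<Rightarrow> 'a \<Rightarrow> 'a" where
  "word_map f \<iota> k = foldr (\<circ>) (map (letter_map f) (stake k \<iota>)) id"

text \<open>For the dual IFS this predicate is used as \<open>point_fibred N (dual f)\<close>; the lemma
  \<open>point_fibred_dual_iff\<close> below rewrites that in terms of \<open>f\<close> and words over the negative
  letters.\<close>

definition point_fibred :: "nat \<Rightarrow> (nat \<Rightarrow> 'a::complete_space \<Rightarrow> 'a) \<Rightarrow> 'a set \<Rightarrow> bool" where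
  "point_fibred N f A \<longleftrightarrow> (\<forall>\<iota>\<in>streams (pos_letters N). \<exists>a\<in>A.
     \<forall>C\<in>nonempty_compacts. C \<subseteq> basin N f A \<longrightarrow>
       hausdorff_tendsto (\<lambda>k. word_map f \<iota> k ` C) {a})"

text \<open>The parameter \<open>B\<close> is the set of admissible base points: the basin of \<open>A\<close> for the coding map
  of \<open>A\<close>, and the basin of the dual attractor with respect to the dual IFS for the dual coding
  map. Both use the maps of the original \<open>f\<close>. The description is well defined on the
  relevant words by \<open>coding_map_tendsto\<close> and \<open>coding_map_dual_tendsto\<close> below.\<close>

definition coding_map ::
    "(nat \<Rightarrow> 'a::complete_space \<Rightarrow> 'a) \<Rightarrow> 'a set \<Rightarrow> int stream \<Rightarrow> 'a" where
  "coding_map f B \<iota> = (THE x. \<forall>b\<in>B. (\<lambda>k. word_map f \<iota> k b) \<longlonglongrightarrow> x)"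

lemma hausdorff_tendsto_singleton:
  "hausdorff_tendsto (\<lambda>k. {x k}) {a} \<longleftrightarrow> x \<longlonglongrightarrow> a"
  unfolding hausdorff_tendsto_def hausdorff_dist_def
  by (subst (2) tendsto_dist_iff) (simp add: dist_commute)

lemma word_map_Suc: "word_map f \<iota> (Suc k) = letter_map f (shd \<iota>) \<circ> word_map f (stl \<iota>) k"
  by (simp add: word_map_def)

lemma word_map_0 [simp]: "word_map f \<iota> 0 = id"
  by (simp add: word_map_def)

lemma word_map_add: "word_map f \<iota> (m + k) = word_map f \<iota> m \<circ> word_map f (sdrop m \<iota>) k"
  by (induction m arbitrary: \<iota>) (simp_all add: word_map_Suc comp_assoc)

lemma ifs_dual: "ifs N f \<Longrightarrow> ifs N (dual f)"
  unfolding ifs_def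
proof (intro conjI ballI; elim conjE)
  fix n assume "\<forall>n\<in>{1..N}. \<exists>g. homeomorphism UNIV UNIV (f n) g" "n \<in> {1..N}"
  then obtain g where g: "homeomorphism UNIV UNIV (f n) g"
    by blast
  then have "dual f n = g"
    unfolding dual_def by (intro inv_equality) (simp_all add: homeomorphism_def)
  with g show "\<exists>g. homeomorphism UNIV UNIV (dual f n) g"
    using homeomorphism_symD by blast
qed

lemma letter_map_dual:
  assumes "ifs N f" "n \<in> pos_letters N \<union> neg_letters N"
  shows "letter_map (dual f) n = letter_map f (- n)"
proof -
  have "bij (f m)" if "m \<in> {1..N}" for m
  proof -
    obtain g where "homeomorphism UNIV UNIV (f m) g"
      using assms(1) \<open>m \<in> {1..N}\<close> unfolding ifs_def by blast
    then have "g \<circ> f m = id" "f m \<circ> g = id"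
      by (auto simp: homeomorphism_def)
    then show ?thesis
      by (rule o_bij)
  qed
  moreover have "n > 0 \<and> nat n \<in> {1..N} \<or> n < 0 \<and> nat (- n) \<in> {1..N}"
    using assms(2) by (auto simp: pos_letters_def neg_letters_def)
  ultimately show ?thesis
    by (auto simp: letter_map_def dual_def inv_inv_eq)
qed

lemma word_map_dual:
  assumes "ifs N f" "\<iota> \<in> streams (pos_letters N \<union> neg_letters N)"
  shows "word_map (dual f) \<iota> k = word_map f (smap uminus \<iota>) k"
  using assms(2)
proof (induction k arbitrary: \<iota>)
  case (Suc k)
  then have "letter_map (dual f) (shd \<iota>) = letter_map f (- shd \<iota>)"
    using letter_map_dual[OF assms(1)] streams_shd by blast
  with Suc show ?case
    by (simp add: word_map_Suc streams_stl)
qed simp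

lemma smap_uminus_streams:
  "\<iota> \<in> streams (neg_letters N) \<longleftrightarrow> smap uminus \<iota> \<in> streams (pos_letters N)"
  by (force simp: streams_iff_sset stream.set_map pos_letters_def neg_letters_def)

lemma smap_uminus_uminus [simp]: "smap uminus (smap uminus \<iota>) = (\<iota> :: int stream)"
  by (simp add: stream.map_comp comp_def stream.map_ident)

lemma point_fibred_dual_iff:
  assumes "ifs N f"
  shows "point_fibred N (dual f) A \<longleftrightarrow> (\<forall>\<iota>\<in>streams (neg_letters N). \<exists>a\<in>A.
     \<forall>C\<in>nonempty_compacts. C \<subseteq> basin N (dual f) A \<longrightarrow>
       hausdorff_tendsto (\<lambda>k. word_map f \<iota> k ` C) {a})"
proof -
  let ?Q = "\<lambda>g \<iota>. \<exists>a\<in>A. \<forall>C\<in>nonempty_compacts. C \<subseteq> basin N (dual f) A \<longrightarrow>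
       hausdorff_tendsto (\<lambda>k. word_map g \<iota> k ` C) {a}"
  have eq: "?Q (dual f) \<iota> \<longleftrightarrow> ?Q f (smap uminus \<iota>)" if "\<iota> \<in> streams (pos_letters N)" for \<iota>
    using word_map_dual[OF assms, of \<iota>] that streams_mono[OF that Un_upper1] by simp
  have "streams (neg_letters N) = smap uminus ` streams (pos_letters N)"
  proof (intro set_eqI iffI)
    fix \<iota> assume "\<iota> \<in> streams (neg_letters N)"
    then have "smap uminus \<iota> \<in> streams (pos_letters N)"
      by (rule smap_uminus_streams[THEN iffD1])
    then show "\<iota> \<in> smap uminus ` streams (pos_letters N)"
      by (rule rev_image_eqI) simp
  next
    fix \<iota> assume "\<iota> \<in> smap uminus ` streams (pos_letters N)"
    then show "\<iota> \<in> streams (neg_letters N)"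
      using smap_uminus_streams by fastforce
  qed
  then have "(\<forall>\<iota>\<in>streams (neg_letters N). ?Q f \<iota>) \<longleftrightarrow>
      (\<forall>\<iota>\<in>streams (pos_letters N). ?Q f (smap uminus \<iota>))"
    by (simp only: ball_simps)
  also have "\<dots> \<longleftrightarrow> (\<forall>\<iota>\<in>streams (pos_letters N). ?Q (dual f) \<iota>)"
    by (intro ball_cong refl eq[symmetric])
  finally show ?thesis
    unfolding point_fibred_def by (rule sym)
qed

lemma continuous_letter_map:
  assumes "ifs N f" "n \<in> pos_letters N \<union> neg_letters N"
  shows "continuous_on UNIV (letter_map f n)"
proof -
  have *: "continuous_on UNIV (g m)" if "ifs N g" "m \<in> {1..N}" for g :: "nat \<Rightarrow> 'a \<Rightarrow> 'a" and m
    using that unfolding ifs_def homeomorphism_def by blast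
  have "n > 0 \<and> nat n \<in> {1..N} \<or> n < 0 \<and> nat (- n) \<in> {1..N}"
    using assms(2) by (auto simp: pos_letters_def neg_letters_def)
  then show ?thesis
    using *[OF assms(1)] *[OF ifs_dual[OF assms(1)]] by (auto simp: letter_map_def dual_def)
qed

lemma continuous_word_map:
  assumes "ifs N f" "\<iota> \<in> streams (pos_letters N \<union> neg_letters N)"
  shows "continuous_on UNIV (word_map f \<iota> k)"
  using assms(2)
proof (induction k arbitrary: \<iota>)
  case (Suc k)
  have "continuous_on UNIV (word_map f (stl \<iota>) k)"
    using Suc streams_stl by blast
  moreover have "continuous_on UNIV (letter_map f (shd \<iota>))"
    using continuous_letter_map[OF assms(1)] Suc.prems streams_shd by blast
  ultimately show ?case
    unfolding word_map_Suc by (metis continuous_on_compose continuous_on_subset subset_UNIV)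
qed (simp add: id_def)

lemma attractor_basin_nonempty: "attractor N f A \<Longrightarrow> basin N f A \<noteq> {}"
  unfolding attractor_def basin_def attracting_nhd_def nonempty_compacts_def by blast

lemma coding_map_tendsto_aux:
  assumes "ifs N f" "\<iota> \<in> streams (pos_letters N \<union> neg_letters N)" "B \<noteq> {}" "b \<in> B"
    and lim: "\<exists>a. \<forall>C\<in>nonempty_compacts. C \<subseteq> B \<longrightarrow>
       hausdorff_tendsto (\<lambda>k. word_map f (sdrop m \<iota>) k ` C) {a}"
  shows "(\<lambda>k. word_map f \<iota> k b) \<longlonglongrightarrow> coding_map f B \<iota>"
proof -
  obtain a where a: "\<And>C. C \<in> nonempty_compacts \<Longrightarrow> C \<subseteq> B \<Longrightarrow>
      hausdorff_tendsto (\<lambda>k. word_map f (sdrop m \<iota>) k ` C) {a}"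
    using lim by blast
  have conv: "(\<lambda>k. word_map f \<iota> k c) \<longlonglongrightarrow> word_map f \<iota> m a" if "c \<in> B" for c
  proof -
    have "(\<lambda>k. word_map f (sdrop m \<iota>) k c) \<longlonglongrightarrow> a"
      using a[of "{c}"] that by (simp add: nonempty_compacts_def hausdorff_tendsto_singleton)
    moreover have "isCont (word_map f \<iota> m) a"
      using continuous_word_map[OF assms(1,2)] by (simp add: continuous_on_eq_continuous_at)
    ultimately have "(\<lambda>k. word_map f \<iota> m (word_map f (sdrop m \<iota>) k c)) \<longlonglongrightarrow> word_map f \<iota> m a"
      by (rule isCont_tendsto_compose[rotated])
    then have "(\<lambda>k. word_map f \<iota> (k + m) c) \<longlonglongrightarrow> word_map f \<iota> m a"
      by (simp add: word_map_add add.commute[of _ m])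
    then show ?thesis
      by (rule LIMSEQ_offset)
  qed
  have "coding_map f B \<iota> = word_map f \<iota> m a"
    unfolding coding_map_def using conv \<open>b \<in> B\<close> by (intro the_equality) (auto intro: LIMSEQ_unique)
  then show ?thesis
    using conv[OF \<open>b \<in> B\<close>] by simp
qed

lemma coding_map_tendsto:
  assumes "ifs N f" "attractor N f A" "point_fibred N f A"
    and "\<iota> \<in> words N" "\<exists>m. sdrop m \<iota> \<in> streams (pos_letters N)" "b \<in> basin N f A"
  shows "(\<lambda>k. word_map f \<iota> k b) \<longlonglongrightarrow> coding_map f (basin N f A) \<iota>"
proof -
  obtain m where "sdrop m \<iota> \<in> streams (pos_letters N)"
    using assms(5) by blast
  with assms(3) have "\<exists>a. \<forall>C\<in>nonempty_compacts. C \<subseteq> basin N f A \<longrightarrow>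
       hausdorff_tendsto (\<lambda>k. word_map f (sdrop m \<iota>) k ` C) {a}"
    unfolding point_fibred_def by blast
  with assms attractor_basin_nonempty[OF assms(2)] show ?thesis
    by (intro coding_map_tendsto_aux) (auto simp: words_def)
qed

lemma coding_map_dual_tendsto:
  assumes "ifs N f" "attractor N (dual f) A" "point_fibred N (dual f) A"
    and "\<iota> \<in> words N" "\<exists>m. sdrop m \<iota> \<in> streams (neg_letters N)" "b \<in> basin N (dual f) A"
  shows "(\<lambda>k. word_map f \<iota> k b) \<longlonglongrightarrow> coding_map f (basin N (dual f) A) \<iota>"
proof -
  obtain m where "sdrop m \<iota> \<in> streams (neg_letters N)"
    using assms(5) by blast
  with assms(3) have "\<exists>a. \<forall>C\<in>nonempty_compacts. C \<subseteq> basin N (dual f) A \<longrightarrow>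
       hausdorff_tendsto (\<lambda>k. word_map f (sdrop m \<iota>) k ` C) {a}"
    unfolding point_fibred_dual_iff[OF assms(1)] by blast
  with assms attractor_basin_nonempty[OF assms(2)] show ?thesis
    by (intro coding_map_tendsto_aux) (auto simp: words_def)
qed

end

theory Submission
  imports Defs
begin

text \<open>If \<open>n\<iota>\<close> is a word that is eventually positive, then \<open>\<pi>(n\<iota>) = f\<^sub>n(\<pi>(\<iota>))\<close> by continuity of \<open>f\<^sub>n\<close>;
  this gives the equivariance with respect to all \<open>\<sigma>\<^sub>n\<close>. Every \<open>a \<in> A\<close> has a backward orbit
  \<open>a = f\<^bsub>\<iota>|k\<^esub>(a\<^sub>k)\<close> inside \<open>A\<close>, so \<open>a\<close> lies in all \<open>f\<^bsub>\<iota>|k\<^esub>(A)\<close> and hence \<open>a = \<pi>(\<iota>)\<close>. As the fast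
  basin is the smallest set that contains \<open>A\<close> and is closed under the inverses of the maps, it is the
  image of the coding map. The dual statement is the first one for the dual IFS, with the sign of all
  letters changed.\<close>

section \<open>Letters, words and the shift\<close>

lemma ifs_inv_f: "ifs N f \<Longrightarrow> n \<in> {1..N} \<Longrightarrow> inv (f n) (f n x) = x"
  and ifs_f_inv: "ifs N f \<Longrightarrow> n \<in> {1..N} \<Longrightarrow> f n (inv (f n) x) = x"
proof -
  assume "ifs N f" "n \<in> {1..N}"
  then obtain g where "homeomorphism UNIV UNIV (f n) g"
    unfolding ifs_def by blast
  then have "g \<circ> f n = id" "f n \<circ> g = id"
    by (auto simp: homeomorphism_def)
  then have "bij (f n)"
    by (rule o_bij)
  then show "inv (f n) (f n x) = x" "f n (inv (f n) x) = x"
    by (simp_all add: bij_is_inj bij_is_surj surj_f_inv_f)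
qed

lemma letter_map_neg_pos:
  assumes "ifs N f" "n \<in> {1..N}"
  shows "letter_map f (- int n) (f n x) = x" "f n (letter_map f (- int n) x) = x"
  using assms ifs_inv_f[OF assms] ifs_f_inv[OF assms] by (auto simp: letter_map_def)

lemma letter_map_cancel:
  assumes "ifs N f" "n \<in> pos_letters N \<union> neg_letters N"
  shows "letter_map f n (letter_map f (- n) x) = x"
proof -
  have "n > 0 \<and> nat n \<in> {1..N} \<or> n < 0 \<and> nat (- n) \<in> {1..N}"
    using assms(2) by (auto simp: pos_letters_def neg_letters_def)
  then show ?thesis
    using ifs_inv_f[OF assms(1)] ifs_f_inv[OF assms(1)] by (auto simp: letter_map_def)
qed

lemma pos_streams_words: "streams (pos_letters N) \<subseteq> words N"
proof
  fix \<iota> assume *: "\<iota> \<in> streams (pos_letters N)"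
  have "\<iota> !! i \<noteq> - (\<iota> !! Suc i)" for i
    using snth_in[OF *, of i] snth_in[OF *, of "Suc i"] by (simp add: pos_letters_def)
  with * show "\<iota> \<in> words N"
    using streams_mono[OF * Un_upper1] by (simp add: words_def)
qed

lemma pos_streams_words_neg_pos: "streams (pos_letters N) \<subseteq> words_neg_pos N"
  using pos_streams_words by (fastforce simp: words_neg_pos_def streams_iff_snth)

lemma words_neg_pos_words: "\<iota> \<in> words_neg_pos N \<Longrightarrow> \<iota> \<in> words N"
  by (simp add: words_neg_pos_def)

lemma words_stl: "\<iota> \<in> words N \<Longrightarrow> stl \<iota> \<in> words N"
  by (simp add: words_def streams_stl flip: snth.simps(2))

lemma words_letters: "\<iota> \<in> words N \<Longrightarrow> \<iota> \<in> streams (pos_letters N \<union> neg_letters N)"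
  by (simp add: words_def)

lemma words_neg_pos_stl:
  assumes "\<iota> \<in> words_neg_pos N"
  shows "stl \<iota> \<in> words_neg_pos N"
proof -
  obtain k where k: "\<forall>j<k. \<iota> !! j \<in> neg_letters N" "\<forall>j\<ge>k. \<iota> !! j \<in> pos_letters N"
    using assms by (auto simp: words_neg_pos_def)
  \<comment> \<open>Subtraction is truncated: for \<open>k = 0\<close> the word is positive
    throughout, and so is its tail.\<close>
  then have "\<forall>j<k - 1. stl \<iota> !! j \<in> neg_letters N" "\<forall>j\<ge>k - 1. stl \<iota> !! j \<in> pos_letters N"
    by (auto simp flip: snth.simps(2))
  with assms show ?thesis
    using words_stl by (auto simp: words_neg_pos_def)
qed

lemma words_neg_pos_eventually_pos:
  "\<iota> \<in> words_neg_pos N \<Longrightarrow> \<exists>m. sdrop m \<iota> \<in> streams (pos_letters N)"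
  unfolding words_neg_pos_def streams_iff_snth sdrop_snth by (blast intro: le_add1)

lemma words_SCons:
  assumes "\<iota> \<in> words N" "n \<in> pos_letters N \<union> neg_letters N" "shd \<iota> \<noteq> - n"
  shows "n ## \<iota> \<in> words N"
proof -
  have "(n ## \<iota>) !! i \<noteq> - ((n ## \<iota>) !! Suc i)" for i
    using assms(1,3) by (cases i) (auto simp: words_def)
  with assms show ?thesis
    by (auto simp: words_def streams_Stream)
qed

lemma words_neg_pos_SCons:
  assumes "\<iota> \<in> words_neg_pos N" "n \<in> neg_letters N" "shd \<iota> \<noteq> - n"
  shows "n ## \<iota> \<in> words_neg_pos N"
proof -
  obtain k where k: "\<forall>j<k. \<iota> !! j \<in> neg_letters N" "\<forall>j\<ge>k. \<iota> !! j \<in> pos_letters N"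
    using assms by (auto simp: words_neg_pos_def)
  have "(n ## \<iota>) !! j \<in> neg_letters N" if "j < Suc k" for j
    using k assms(2) that by (cases j) auto
  moreover have "(n ## \<iota>) !! j \<in> pos_letters N" if "j \<ge> Suc k" for j
    using k that by (cases j) auto
  moreover have "n ## \<iota> \<in> words N"
    using assms by (intro words_SCons words_neg_pos_words) auto
  ultimately show ?thesis
    unfolding words_neg_pos_def by blast
qed

text \<open>A negative letter either lengthens the negative prefix or cancels a leading positive
  letter. A positive letter put before a negative one would destroy the order of signs.\<close>

lemma shift_letter_words_neg_pos:
  "n \<in> neg_letters N \<Longrightarrow> \<iota> \<in> words_neg_pos N \<Longrightarrow> shift_letter n \<iota> \<in> words_neg_pos N"
  by (simp add: shift_letter_def words_neg_pos_stl words_neg_pos_SCons)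

section \<open>Equivariance of the coding map\<close>

text \<open>Both sides are limits of \<open>word_map f \<iota> (Suc k) b\<close>: the left as a
  sequence shifted by one index, the right by continuity of the map of the first letter.\<close>

lemma coding_map_shd:
  assumes "ifs N f" "attractor N f A" "point_fibred N f A" "\<iota> \<in> words N"
    and "\<exists>m. sdrop m (stl \<iota>) \<in> streams (pos_letters N)"
  defines "\<pi> \<equiv> coding_map f (basin N f A)"
  shows "\<pi> \<iota> = letter_map f (shd \<iota>) (\<pi> (stl \<iota>))"
proof -
  obtain b where b: "b \<in> basin N f A"
    using attractor_basin_nonempty[OF assms(2)] by blast
  have "\<exists>m. sdrop m \<iota> \<in> streams (pos_letters N)"
    using assms(5) by (metis sdrop.simps(2))
  then have 1: "(\<lambda>k. word_map f \<iota> k b) \<longlonglongrightarrow> \<pi> \<iota>"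
    unfolding \<pi>_def using assms b by (intro coding_map_tendsto)
  have "(\<lambda>k. word_map f (stl \<iota>) k b) \<longlonglongrightarrow> \<pi> (stl \<iota>)"
    unfolding \<pi>_def using assms b by (intro coding_map_tendsto words_stl)
  moreover have "isCont (letter_map f (shd \<iota>)) x" for x
    using continuous_letter_map[OF assms(1)] streams_shd[OF words_letters[OF assms(4)]]
    by (simp add: continuous_on_eq_continuous_at)
  ultimately have "(\<lambda>k. letter_map f (shd \<iota>) (word_map f (stl \<iota>) k b))
      \<longlonglongrightarrow> letter_map f (shd \<iota>) (\<pi> (stl \<iota>))"
    by (rule isCont_tendsto_compose[rotated])
  then have "(\<lambda>k. word_map f \<iota> (Suc k) b) \<longlonglongrightarrow> letter_map f (shd \<iota>) (\<pi> (stl \<iota>))"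
    by (simp add: word_map_Suc)
  with LIMSEQ_Suc[OF 1] show ?thesis
    by (rule LIMSEQ_unique)
qed

text \<open>When the letter cancels, \<open>coding_map_shd\<close> is read backwards: it writes
  \<open>\<pi> \<iota>\<close> as the image of \<open>\<pi> (stl \<iota>)\<close> under the map of
  \<open>- n\<close>, which the map of \<open>n\<close> undoes. Otherwise it applies directly to
  \<open>n ## \<iota>\<close>.\<close>

lemma coding_map_shift_letter:
  assumes "ifs N f" "attractor N f A" "point_fibred N f A"
    and "\<iota> \<in> words N" "\<exists>m. sdrop m \<iota> \<in> streams (pos_letters N)"
    and n: "n \<in> pos_letters N \<union> neg_letters N"
  defines "\<pi> \<equiv> coding_map f (basin N f A)"
  shows "\<pi> (shift_letter n \<iota>) = letter_map f n (\<pi> \<iota>)"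
proof (cases "shd \<iota> = - n")
  case True
  obtain m where m: "sdrop m \<iota> \<in> streams (pos_letters N)"
    using assms(5) by blast
  then have "sdrop m (stl \<iota>) \<in> streams (pos_letters N)"
    by (metis sdrop_stl streams_stl)
  then have "\<pi> \<iota> = letter_map f (- n) (\<pi> (stl \<iota>))"
    unfolding \<pi>_def using coding_map_shd[OF assms(1-4)] True by metis
  with True show ?thesis
    using letter_map_cancel[OF assms(1) n] by (simp add: shift_letter_def)
next
  case False
  have "n ## \<iota> \<in> words N" "\<exists>m. sdrop m (stl (n ## \<iota>)) \<in> streams (pos_letters N)"
    using words_SCons[OF assms(4) n False] assms(5) by simp_all
  from coding_map_shd[OF assms(1-3) this] False show ?thesis
    by (simp add: shift_letter_def \<pi>_def)
qed

section \<open>Positive words code exactly the points of the attractor\<close>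

lemma hausdorff_tendsto_singleton_mem:
  assumes "hausdorff_tendsto S {b}" "\<And>k. compact (S k)" "\<And>k. a \<in> S k"
  shows "a = b"
proof -
  have "dist a b \<le> hausdorff_dist (S k) {b}" for k
  proof -
    \<comment> \<open>Compactness bounds the distances, so the real supremum is a genuine upper
      bound for each of them.\<close>
    have "compact ((\<lambda>x. infdist x {b}) ` S k)"
      using assms(2) by (intro compact_continuous_image continuous_intros) auto
    then have "infdist a {b} \<le> (SUP x\<in>S k. infdist x {b})"
      using assms(3) by (intro cSUP_upper bounded_imp_bdd_above compact_imp_bounded)
    then show ?thesis
      by (simp add: hausdorff_dist_def)
  qed
  then have "dist a b \<le> 0"
    using assms(1) unfolding hausdorff_tendsto_def by (intro LIMSEQ_le_const) auto
  then show ?thesis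
    by simp
qed

lemma attractor_subset_basin: "attractor N f A \<Longrightarrow> A \<subseteq> basin N f A"
  unfolding attractor_def basin_def attracting_nhd_def by blast

text \<open>Point-fibredness only yields some limit point \<open>a\<close>; testing it on a
  singleton \<open>{b}\<close> identifies \<open>a\<close> with the value of the coding map.\<close>

lemma coding_map_pos:
  assumes "ifs N f" "attractor N f A" "point_fibred N f A" "\<iota> \<in> streams (pos_letters N)"
  defines "\<pi> \<equiv> coding_map f (basin N f A)"
  shows "\<pi> \<iota> \<in> A"
    and "\<And>C. C \<in> nonempty_compacts \<Longrightarrow> C \<subseteq> basin N f A \<Longrightarrow>
      hausdorff_tendsto (\<lambda>k. word_map f \<iota> k ` C) {\<pi> \<iota>}"
proof -
  obtain a where a: "a \<in> A" "\<And>C. C \<in> nonempty_compacts \<Longrightarrow> C \<subseteq> basin N f A \<Longrightarrow>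
      hausdorff_tendsto (\<lambda>k. word_map f \<iota> k ` C) {a}"
    using assms(3,4) unfolding point_fibred_def by blast
  obtain b where b: "b \<in> basin N f A"
    using attractor_basin_nonempty[OF assms(2)] by blast
  have "\<iota> \<in> words N" "\<exists>m. sdrop m \<iota> \<in> streams (pos_letters N)"
    using assms(4) pos_streams_words by (auto intro: exI[of _ 0])
  then have "(\<lambda>k. word_map f \<iota> k b) \<longlonglongrightarrow> \<pi> \<iota>"
    unfolding \<pi>_def using assms b by (intro coding_map_tendsto)
  moreover have "(\<lambda>k. word_map f \<iota> k b) \<longlonglongrightarrow> a"
    using a(2)[of "{b}"] b by (simp add: nonempty_compacts_def hausdorff_tendsto_singleton)
  ultimately have "\<pi> \<iota> = a"
    by (rule LIMSEQ_unique)
  with a show "\<pi> \<iota> \<in> A"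
    and "\<And>C. C \<in> nonempty_compacts \<Longrightarrow> C \<subseteq> basin N f A \<Longrightarrow>
      hausdorff_tendsto (\<lambda>k. word_map f \<iota> k ` C) {\<pi> \<iota>}"
    by auto
qed

lemma backward_orbit:
  assumes "A \<subseteq> hutchinson N f A" "a \<in> A"
  obtains \<iota> where "\<iota> \<in> streams (pos_letters N)" "\<And>k. a \<in> word_map f \<iota> k ` A"
proof -
  have "\<forall>x\<in>A. \<exists>n y. n \<in> {1..N} \<and> y \<in> A \<and> x = f n y"
    using assms(1) unfolding hutchinson_def by blast
  then obtain c p where cp: "\<And>x. x \<in> A \<Longrightarrow> c x \<in> {1..N} \<and> p x \<in> A \<and> x = f (c x) (p x)"
    by metis
  \<comment> \<open>\<open>p\<close> chooses a preimage inside \<open>A\<close> and \<open>c\<close>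
    the index of the map leading back, so \<open>orbit x\<close> lists the letters met along
    \<open>x\<close>, \<open>p x\<close>, \<open>p (p x)\<close>, and so on. Its tail is
    \<open>orbit (p x)\<close>, which drives the induction below.\<close>
  define orbit where "orbit = smap (\<lambda>x. int (c x)) \<circ> siterate p"
  have shd: "shd (orbit x) = int (c x)" and stl: "stl (orbit x) = orbit (p x)" for x
    by (simp_all add: orbit_def)
  have "x \<in> word_map f (orbit x) k ` A" if "x \<in> A" for x k
    using that
  proof (induction k arbitrary: x)
    case (Suc k)
    have "letter_map f (int (c x)) (p x) = x" "p x \<in> word_map f (orbit (p x)) k ` A"
      using cp[OF Suc.prems] Suc.IH by (auto simp: letter_map_def)
    then show ?case
      by (force simp: word_map_Suc shd stl image_comp[symmetric])
  qed simp
  moreover have "(p ^^ i) a \<in> A" for i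
    by (induction i) (use assms(2) cp in auto)
  then have "orbit a \<in> streams (pos_letters N)"
    using cp by (fastforce simp: orbit_def streams_iff_snth pos_letters_def)
  ultimately show ?thesis
    using that assms(2) by blast
qed

lemma coding_map_pos_image:
  assumes "ifs N f" "attractor N f A" "point_fibred N f A"
  shows "coding_map f (basin N f A) ` streams (pos_letters N) = A"
proof (intro subset_antisym subsetI)
  fix a assume "a \<in> A"
  have A: "A \<in> nonempty_compacts" "hutchinson N f A = A"
    using assms(2) by (auto simp: attractor_def)
  then obtain \<iota> where \<iota>: "\<iota> \<in> streams (pos_letters N)" "\<And>k. a \<in> word_map f \<iota> k ` A"
    using backward_orbit[of A N f a] \<open>a \<in> A\<close> by blast
  \<comment> \<open>The attractor itself serves as the compact test set, since it lies in its own
    basin.\<close>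
  have "hausdorff_tendsto (\<lambda>k. word_map f \<iota> k ` A) {coding_map f (basin N f A) \<iota>}"
    using assms \<iota>(1) A(1) attractor_subset_basin by (intro coding_map_pos)
  moreover have "compact (word_map f \<iota> k ` A)" for k
    using continuous_word_map[OF assms(1) streams_mono[OF \<iota>(1) Un_upper1]] A(1)
    by (intro compact_continuous_image) (auto intro: continuous_on_subset simp: nonempty_compacts_def)
  ultimately have "a = coding_map f (basin N f A) \<iota>"
    using \<iota>(2) by (rule hausdorff_tendsto_singleton_mem)
  with \<iota>(1) show "a \<in> coding_map f (basin N f A) ` streams (pos_letters N)"
    by blast
qed (use assms coding_map_pos(1) in blast)

section \<open>Closure properties and minimality of the fast basin\<close>

lemma hutchinson_mono: "mono (hutchinson N f)"
  by (auto simp: mono_def hutchinson_def)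

lemma attractor_subset_fast_basin:
  assumes "hutchinson N f A \<subseteq> A" "1 \<le> N"
  shows "A \<subseteq> fast_basin N f A"
proof
  fix x assume "x \<in> A"
  \<comment> \<open>The definition demands at least one iteration, so membership of \<open>x\<close>
    in \<open>A\<close> is not enough; one map leads from \<open>x\<close> into \<open>A\<close>
    again.\<close>
  with assms have "f 1 x \<in> (hutchinson N f ^^ 1) {x} \<inter> A"
    by (fastforce simp: hutchinson_def)
  then show "x \<in> fast_basin N f A"
    unfolding fast_basin_def by blast
qed

text \<open>An orbit from \<open>f n y\<close> that reaches \<open>A\<close> becomes one from
  \<open>y\<close> by one additional first step.\<close>

lemma fast_basin_preimage:
  assumes "n \<in> {1..N}" "f n y \<in> fast_basin N f A"
  shows "y \<in> fast_basin N f A"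
proof -
  obtain K where K: "(hutchinson N f ^^ K) {f n y} \<inter> A \<noteq> {}"
    using assms(2) by (auto simp: fast_basin_def)
  have "{f n y} \<subseteq> hutchinson N f {y}"
    using assms(1) by (auto simp: hutchinson_def)
  then have "(hutchinson N f ^^ K) {f n y} \<subseteq> (hutchinson N f ^^ Suc K) {y}"
    using funpow_mono[OF hutchinson_mono] by (simp only: funpow_Suc_right comp_apply)
  with K have "(hutchinson N f ^^ Suc K) {y} \<inter> A \<noteq> {}"
    by blast
  then show ?thesis
    unfolding fast_basin_def by (intro CollectI exI[of _ "Suc K"]) simp
qed

lemma fast_basin_least:
  assumes "A \<subseteq> P" "\<And>n x. n \<in> {1..N} \<Longrightarrow> f n x \<in> P \<Longrightarrow> x \<in> P"
  shows "fast_basin N f A \<subseteq> P"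
proof -
  \<comment> \<open>The start is an arbitrary set \<open>S\<close>, because the image of a singleton
    under \<open>hutchinson N f\<close> need not be a singleton. Each induction step splits off the
    first iteration and pulls a point of \<open>P\<close> back along one map.\<close>
  have "S \<inter> P \<noteq> {}" if "(hutchinson N f ^^ K) S \<inter> A \<noteq> {}" for K S
    using that
  proof (induction K arbitrary: S)
    case 0
    then show ?case
      using assms(1) by auto
  next
    case (Suc K)
    then have "hutchinson N f S \<inter> P \<noteq> {}"
      by (simp add: funpow_Suc_right del: funpow.simps)
    then show ?case
      using assms(2) by (fastforce simp: hutchinson_def)
  qed
  then show ?thesis
    unfolding fast_basin_def by blast
qed

lemma fast_basin_letter_map:
  assumes "ifs N f" "n \<in> neg_letters N" "x \<in> fast_basin N f A"
  shows "letter_map f n x \<in> fast_basin N f A"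
proof -
  have "nat (- n) \<in> {1..N}" "n = - int (nat (- n))"
    using assms(2) by (auto simp: neg_letters_def)
  \<comment> \<open>\<open>x\<close> is the image of \<open>letter_map f n x\<close> under
    \<open>f (nat (- n))\<close>, so the closure under preimages applies.\<close>
  then show ?thesis
    using assms(1,3) fast_basin_preimage letter_map_neg_pos(2) by metis
qed

section \<open>The image of the coding map\<close>

lemma coding_map_image:
  assumes "ifs N f" "attractor N f A" "point_fibred N f A"
  defines "\<pi> \<equiv> coding_map f (basin N f A)"
  shows "\<pi> ` words_neg_pos N = fast_basin N f A"
proof
  have A: "\<pi> ` streams (pos_letters N) = A"
    unfolding \<pi>_def using assms by (intro coding_map_pos_image)
  show "fast_basin N f A \<subseteq> \<pi> ` words_neg_pos N"
  proof (rule fast_basin_least)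
    show "A \<subseteq> \<pi> ` words_neg_pos N"
      using A pos_streams_words_neg_pos by blast
  next
    fix n x assume n: "n \<in> {1..N}" and "f n x \<in> \<pi> ` words_neg_pos N"
    then obtain \<iota> where \<iota>: "\<iota> \<in> words_neg_pos N" "f n x = \<pi> \<iota>"
      by blast
    have neg: "- int n \<in> neg_letters N"
      using n by (auto simp: neg_letters_def)
    \<comment> \<open>A word for \<open>f n x\<close> yields one for \<open>x\<close>: the shift by
      the negative letter applies the inverse of \<open>f n\<close>.\<close>
    then have "\<pi> (shift_letter (- int n) \<iota>) = letter_map f (- int n) (\<pi> \<iota>)"
      unfolding \<pi>_def using assms \<iota>(1)
      by (intro coding_map_shift_letter words_neg_pos_words words_neg_pos_eventually_pos) auto
    also have "\<dots> = x"
      using letter_map_neg_pos(1)[OF assms(1) n] by (simp flip: \<iota>(2))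
    finally show "x \<in> \<pi> ` words_neg_pos N"
      using shift_letter_words_neg_pos[OF neg \<iota>(1)] by blast
  qed
  have fb: "A \<subseteq> fast_basin N f A"
    using assms(1,2) by (intro attractor_subset_fast_basin) (auto simp: attractor_def ifs_def)
  \<comment> \<open>Induction on the length \<open>m\<close> of a prefix followed by positive
    letters only. The prefix need not be minimal and may contain positive letters, hence the case
    split on the first letter.\<close>
  have "\<pi> \<iota> \<in> fast_basin N f A"
    if "\<iota> \<in> words_neg_pos N" "sdrop m \<iota> \<in> streams (pos_letters N)" for m \<iota>
    using that
  proof (induction m arbitrary: \<iota>)
    case 0
    then show ?case
      using A fb by auto
  next
    case (Suc m)
    show ?case
    proof (cases "shd \<iota> \<in> neg_letters N")
      case True
      have "\<pi> \<iota> = letter_map f (shd \<iota>) (\<pi> (stl \<iota>))"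
        unfolding \<pi>_def using assms Suc.prems
        by (intro coding_map_shd words_neg_pos_words) auto
      then show ?thesis
        using Suc words_neg_pos_stl True fast_basin_letter_map[OF assms(1)] by simp
    next
      case False
      \<comment> \<open>Without a negative first letter there is no negative prefix: the whole word
        is positive and codes a point of \<open>A\<close>.\<close>
      obtain k where k: "\<forall>j<k. \<iota> !! j \<in> neg_letters N" "\<forall>j\<ge>k. \<iota> !! j \<in> pos_letters N"
        using Suc.prems(1) by (auto simp: words_neg_pos_def)
      with False have "k = 0"
        by (metis gr0I snth.simps(1))
      with k have "\<iota> \<in> streams (pos_letters N)"
        by (simp add: streams_iff_snth)
      then show ?thesis
        using A fb by auto
    qed
  qed
  then show "\<pi> ` words_neg_pos N \<subseteq> fast_basin N f A"
    using words_neg_pos_eventually_pos by blast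
qed

section \<open>Sign change and the dual system\<close>

lemma words_pos_neg_eq: "words_pos_neg N = smap uminus ` words_neg_pos N"
proof -
  have sign: "- n \<in> pos_letters N \<longleftrightarrow> n \<in> neg_letters N"
    "- n \<in> neg_letters N \<longleftrightarrow> n \<in> pos_letters N" for n
    by (auto simp: pos_letters_def neg_letters_def)
  have words: "smap uminus \<iota> \<in> words N \<longleftrightarrow> \<iota> \<in> words N" for \<iota>
    unfolding words_def by (simp add: streams_iff_snth sign disj_commute)
      (metis (no_types) minus_minus)
  \<comment> \<open>As the sign change is an involution, this equivalence is enough to describe the
    image.\<close>
  have "smap uminus \<iota> \<in> words_neg_pos N \<longleftrightarrow> \<iota> \<in> words_pos_neg N" for \<iota>
    by (simp add: words_neg_pos_def words_pos_neg_def sign words)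
  then show ?thesis
    by (metis (no_types, lifting) smap_uminus_uminus image_iff set_eqI)
qed

lemma shift_letter_smap_uminus:
  "shift_letter n (smap uminus \<iota>) = smap uminus (shift_letter (- n) \<iota>)"
  by (auto simp: shift_letter_def)

text \<open>Changing signs exchanges \<open>f\<close> and \<open>dual f\<close> in every finite
  composition, so both sides are defined by the same sequences with the same base points.\<close>

lemma coding_map_smap_uminus:
  assumes "ifs N f" "\<iota> \<in> words N"
  shows "coding_map f B (smap uminus \<iota>) = coding_map (dual f) B \<iota>"
  unfolding coding_map_def using word_map_dual[OF assms(1) words_letters[OF assms(2)]] by simp

theorem corollary5p7:
  fixes N :: nat and f :: "nat \<Rightarrow> 'a::complete_space \<Rightarrow> 'a" and A :: "'a set"
  assumes "ifs N f" and "attractor N f A" and "point_fibred N f A"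
  shows "(let \<pi> = coding_map f (basin N f A) in
       \<pi> ` words_neg_pos N = fast_basin N f A \<and>
       (\<forall>n\<in>neg_letters N.
          shift_letter n \<in> words_neg_pos N \<rightarrow> words_neg_pos N \<and>
          letter_map f n \<in> fast_basin N f A \<rightarrow> fast_basin N f A \<and>
          (\<forall>\<iota>\<in>words_neg_pos N. (\<pi> \<circ> shift_letter n) \<iota> = (letter_map f n \<circ> \<pi>) \<iota>))) \<and>
     (let A' = - basin N f A; \<pi>' = coding_map f (basin N (dual f) A') in
       attractor N (dual f) A' \<and> point_fibred N (dual f) A' \<longrightarrow>
       \<pi>' ` words_pos_neg N = fast_basin N (dual f) A' \<and>
       (\<forall>n\<in>pos_letters N.
          shift_letter n \<in> words_pos_neg N \<rightarrow> words_pos_neg N \<and>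
          letter_map f n \<in> fast_basin N (dual f) A' \<rightarrow> fast_basin N (dual f) A' \<and>
          (\<forall>\<iota>\<in>words_pos_neg N. (\<pi>' \<circ> shift_letter n) \<iota> = (letter_map f n \<circ> \<pi>') \<iota>)))"
proof -
  \<comment> \<open>Stated for an arbitrary system \<open>g\<close>, so that it serves both for
    \<open>f\<close> and for \<open>dual f\<close>.\<close>
  have main: "coding_map g (basin N g D) ` words_neg_pos N = fast_basin N g D \<and>
       (\<forall>n\<in>neg_letters N.
          shift_letter n \<in> words_neg_pos N \<rightarrow> words_neg_pos N \<and>
          letter_map g n \<in> fast_basin N g D \<rightarrow> fast_basin N g D \<and>
          (\<forall>\<iota>\<in>words_neg_pos N. coding_map g (basin N g D) (shift_letter n \<iota>) =
             letter_map g n (coding_map g (basin N g D) \<iota>)))"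
    if "ifs N g" "attractor N g D" "point_fibred N g D" for g :: "nat \<Rightarrow> 'a \<Rightarrow> 'a" and D
    using coding_map_image[OF that] shift_letter_words_neg_pos fast_basin_letter_map[OF that(1)]
      coding_map_shift_letter[OF that words_neg_pos_words words_neg_pos_eventually_pos]
    by (simp add: Pi_iff)
  \<comment> \<open>\<open>B\<close> abbreviates the dual basin. Folding it into \<open>main\<close>
    for \<open>dual f\<close> gives both coding maps the same base points, as
    \<open>coding_map_smap_uminus\<close> requires.\<close>
  have dual: "coding_map f B ` words_pos_neg N = fast_basin N (dual f) D \<and>
       (\<forall>n\<in>pos_letters N.
          shift_letter n \<in> words_pos_neg N \<rightarrow> words_pos_neg N \<and>
          letter_map f n \<in> fast_basin N (dual f) D \<rightarrow> fast_basin N (dual f) D \<and>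
          (\<forall>\<iota>\<in>words_pos_neg N. coding_map f B (shift_letter n \<iota>) =
             letter_map f n (coding_map f B \<iota>)))"
    if "attractor N (dual f) D" "point_fibred N (dual f) D" "B = basin N (dual f) D" for B D
  proof -
    note * = main[OF ifs_dual[OF assms(1)] that(1,2), folded that(3)]
    have \<pi>: "coding_map f B (smap uminus \<iota>) = coding_map (dual f) B \<iota>"
      if "\<iota> \<in> words_neg_pos N" for \<iota>
      using assms(1) words_neg_pos_words[OF that] by (rule coding_map_smap_uminus)
    have "coding_map f B ` words_pos_neg N = fast_basin N (dual f) D"
      using * \<pi> by (simp add: words_pos_neg_eq image_image)
    moreover have "shift_letter n \<in> words_pos_neg N \<rightarrow> words_pos_neg N"
      "letter_map f n \<in> fast_basin N (dual f) D \<rightarrow> fast_basin N (dual f) D"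
      "\<forall>\<iota>\<in>words_pos_neg N. coding_map f B (shift_letter n \<iota>) = letter_map f n (coding_map f B \<iota>)"
      if "n \<in> pos_letters N" for n
    proof -
      have n: "- n \<in> neg_letters N"
        using that by (auto simp: pos_letters_def neg_letters_def)
      \<comment> \<open>A positive letter acts through \<open>f\<close> as its negative does through
        \<open>dual f\<close>, which brings in the result for negative letters.\<close>
      then have f: "letter_map f n = letter_map (dual f) (- n)"
        using letter_map_dual[OF assms(1), of "- n"] by simp
      note ** = bspec[OF conjunct2[OF *] n]
      show "shift_letter n \<in> words_pos_neg N \<rightarrow> words_pos_neg N"
        using shift_letter_words_neg_pos[OF n]
        by (auto simp: words_pos_neg_eq shift_letter_smap_uminus)
      show "letter_map f n \<in> fast_basin N (dual f) D \<rightarrow> fast_basin N (dual f) D"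
        using ** f by simp
      show "\<forall>\<iota>\<in>words_pos_neg N.
          coding_map f B (shift_letter n \<iota>) = letter_map f n (coding_map f B \<iota>)"
        using ** shift_letter_words_neg_pos[OF n]
        by (auto simp: words_pos_neg_eq shift_letter_smap_uminus \<pi> f)
    qed
    ultimately show ?thesis
      by blast
  qed
  show ?thesis
    unfolding Let_def comp_apply
    by (intro conjI[OF main[OF assms]] impI dual[OF _ _ refl]) (elim conjE, assumption)+
qed

end
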